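(* Let $k\ge 1$ be an integer and let $J_\infty(s_2)$ be the infinite modular Jaco-type graph modulo $k$, with vertices $v_1,v_2,v_3,\ldots$. If $k$ is even, then the sequence of in-degrees $(d^-(v_i))_{i\ge 1}$ is $$0,1,1,2,2,3,3,\ldots,\tfrac{k}{2}-1,\tfrac{k}{2}-1,\tfrac{k}{2},\ \tfrac{k}{2}-1,\tfrac{k}{2},\tfrac{k}{2}-1,\tfrac{k}{2},\ldots,$$ where the first $k$ in-degrees are $0,1,1,2,2,\ldots,\frac{k}{2}-1,\frac{k}{2}-1,\frac{k}{2}$ (with $\frac{k}{2}$ occurring once), and thereafter $\frac{k}{2}-1,\frac{k}{2}$ alternate forever. That is, $d^-(v_i)=\lfloor i/2\rfloor$ for $1\le i\le k$, and for $i>k$, $d^-(v_i)=\frac{k}{2}-1$ if $i$ is odd and $d^-(v_i)=\frac{k}{2}$ if $i$ is even. If $k$ is odd, then the sequence of in-degrees $(d^-(v_i))_{i\ge 1}$ is $$0,1,1,2,2,3,3,\ldots,\lfloor\tfrac{k}{2}\rfloor,\lfloor\tfrac{k}{2}\rfloor,\ \lfloor\tfrac{k}{2}\rfloor,\lfloor\tfrac{k}{2}\rfloor,\lfloor\tfrac{k}{2}\rfloor,\ldots,$$ where the first $k$ in-degrees are $0,1,1,2,2,\ldots,\lfloor\frac{k}{2}\rfloor,\lfloor\frac{k}{2}\rfloor$ and all subsequent in-degrees equal $\lfloor\frac{k}{2}\rfloor$. That is, $d^-(v_i)=\lfloor i/2\rfloor$ for $1\le i\le k$, and $d^-(v_i)=\lfloor\frac{k}{2}\rfloor$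 for all $i>k$.
   Context: $\mathbb{N}=\{1,2,3,\ldots\}$. For an integer $k\ge 1$, let $s_2=\{a_n\}_{n\in\mathbb{N}}$ be the sequence with $a_n\in\{0,1,\ldots,k-1\}$ and $a_n\equiv n \pmod k$. The infinite modular Jaco-type graph modulo $k$, denoted $J_\infty(s_2)$, is the directed graph with vertex set $\{v_i: i\in\mathbb{N}\}$ in which $(v_i,v_j)$ is an arc (from $v_i$ to $v_j$) if and only if $i<j$ and $a_i+i\ge j$. (The requirement that the sequence be non-decreasing, usual for Jaco-type graphs, is relaxed here; each vertex $v_i$ has out-degree $a_i$.) $d^-(v)$ denotes the in-degree of the vertex $v$. *)

theory Defs
  imports "Graph_Theory.Digraph"
begin

text \<open>The vertex \<open>v\<^sub>i\<close> is represented by its index \<open>i \<ge> 1\<close>; index 0 is not a vertex, and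
  the value \<open>a 0\<close> is irrelevant. An arc is its pair of endpoints.\<close>

definition jaco_graph :: "(nat \<Rightarrow> nat) \<Rightarrow> (nat, nat \<times> nat) pre_digraph" where
  "jaco_graph a =
     \<lparr> verts = {1..},
       arcs = {(i, j). 1 \<le> i \<and> i < j \<and> j \<le> a i + i},
       tail = fst,
       head = snd \<rparr>"

definition modular_seq :: "nat \<Rightarrow> nat \<Rightarrow> nat" where
  "modular_seq k n = n mod k"

abbreviation modular_jaco_graph :: "nat \<Rightarrow> (nat, nat \<times> nat) pre_digraph" where
  "modular_jaco_graph k \<equiv> jaco_graph (modular_seq k)"

lemma loopfree_digraph_jaco_graph: "loopfree_digraph (jaco_graph a)"
  by unfold_locales (auto simp: jaco_graph_def)

lemma nomulti_digraph_jaco_graph: "nomulti_digraph (jaco_graph a)"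
  by unfold_locales (auto simp: jaco_graph_def arc_to_ends_def)

text \<open>In-degrees are cardinalities of finite sets, so \<^const>\<open>in_degree\<close> never takes
  the default value that \<^const>\<open>card\<close> assigns to infinite sets.\<close>

lemma finite_in_arcs_jaco_graph: "finite (in_arcs (jaco_graph a) j)"
  by (rule finite_subset[of _ "{..j} \<times> {..j}"]) (auto simp: jaco_graph_def)

lemma out_degree_jaco_graph:
  assumes "i \<ge> 1"
  shows "out_degree (jaco_graph a) i = a i"
proof -
  have "out_arcs (jaco_graph a) i = Pair i ` {i<..a i + i}"
    using assms by (auto simp: jaco_graph_def)
  then show ?thesis
    by (simp add: out_degree_def card_image inj_on_def)
qed

end

theory Submission
  imports Defs
begin

text \<open>A vertex \<open>i = p * k + m\<close> with \<open>m < k\<close> reaches exactly up to \<open>i + m < (p + 2) * k\<close>. Hence an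
  in-neighbour of \<open>j = q * k + r\<close>, \<open>r < k\<close>, lies in the same block of length \<open>k\<close> as \<open>j\<close>
  (with residue \<open>m < r \<le> 2 * m\<close>, giving \<open>\<lfloor>r/2\<rfloor>\<close> vertices) or in the preceding block
  (with \<open>k + r \<le> 2 * m\<close>, giving \<open>\<lfloor>(k - r)/2\<rfloor>\<close> vertices).\<close>

lemma in_degree_jaco_graph:
  "in_degree (jaco_graph a) j = card {i. 1 \<le> i \<and> i < j \<and> j \<le> a i + i}"
proof -
  have "in_arcs (jaco_graph a) j = (\<lambda>i. (i, j)) ` {i. 1 \<le> i \<and> i < j \<and> j \<le> a i + i}"
    by (auto simp: jaco_graph_def)
  then show ?thesis
    by (simp add: in_degree_def card_image inj_on_def)
qed

text \<open>Below \<open>k\<close> every index is its own residue, so the arc condition reduces to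
  \<open>j \<le> 2 * i\<close>.\<close>

lemma in_degree_modular_jaco_graph_first_block:
  assumes "j < k"
  shows "in_degree (modular_jaco_graph k) j = j div 2"
proof -
  have "{i. 1 \<le> i \<and> i < j \<and> j \<le> modular_seq k i + i} = {(j + 1) div 2..<j}"
    using assms by (auto simp: modular_seq_def)
  then show ?thesis
    by (simp add: in_degree_jaco_graph)
qed

lemma in_degree_modular_jaco_graph_later_block:
  assumes "r < k"
  shows "in_degree (modular_jaco_graph k) (p * k + k + r) = r div 2 + (k - r) div 2"
proof -
  define j where "j = p * k + k + r"
  \<comment> \<open>The \<open>+ 1\<close> rounds the lower bounds r/2 and (k + r)/2 up, so that
    counting the intervals rounds down. As \<open>k > 0\<close>, neither set contains the non-vertex
    0.\<close>
  define A where "A = {p * k + k + (r + 1) div 2..<j}"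
  define B where "B = {p * k + (k + r + 1) div 2..<p * k + k}"
  have "(1 \<le> i \<and> i < j \<and> j \<le> modular_seq k i + i) \<longleftrightarrow> i \<in> A \<union> B" for i
  proof -
    consider "i < p * k" | m where "i = p * k + m" "m < k" | m where "i = p * k + k + m"
      by (metis add_less_cancel_left le_add_diff_inverse not_le)
    then show ?thesis
    proof cases
      case 1
      moreover have "i mod k < k"
        using assms by simp
      ultimately have "i mod k + i < p * k + k"
        by linarith
      with 1 show ?thesis
        by (auto simp: A_def B_def j_def modular_seq_def)
    next
      case (2 m)
      then have "i mod k = m"
        by simp
      with 2 assms show ?thesis
        by (auto simp: A_def B_def j_def modular_seq_def)
    next
      case (3 m)
      \<comment> \<open>This case leaves \<open>m\<close> unbounded in order to cover all later
        blocks. If \<open>m \<ge> k\<close>, then \<open>m > r\<close> and hence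
        \<open>i > j\<close>, so both sides are false whatever the residue.\<close>
      have "i mod k = m" if "m < k"
        using that mod_mult_self3[of "Suc p" k m] by (simp add: 3 ac_simps)
      with 3 assms show ?thesis
        by (auto simp: A_def B_def j_def modular_seq_def)
    qed
  qed
  then have "{i. 1 \<le> i \<and> i < j \<and> j \<le> modular_seq k i + i} = A \<union> B"
    by blast
  moreover have "A \<inter> B = {}"
    by (auto simp: A_def B_def)
  ultimately have "in_degree (modular_jaco_graph k) j = card A + card B"
    by (simp add: in_degree_jaco_graph card_Un_disjoint A_def B_def)
  also have "card A = r div 2"
    by (simp add: A_def j_def)
  also have "card B = (k - r) div 2"
    using assms by (simp add: B_def)
  finally show ?thesis
    by (simp add: j_def)
qed

lemma in_degree_modular_jaco_graph:
  assumes "k \<ge> 1"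
  shows "in_degree (modular_jaco_graph k) j =
    (if j < k then j div 2 else (j mod k) div 2 + (k - j mod k) div 2)"
proof (cases "j < k")
  case False
  \<comment> \<open>The index of the block before that of \<open>j\<close>; the subtraction does not
    truncate, since \<open>j \<ge> k\<close>.\<close>
  define p where "p = j div k - 1"
  have "j div k = Suc p"
    using False assms by (simp add: p_def div_greater_zero_iff)
  then have "j = p * k + k + j mod k"
    by (metis add.commute div_mult_mod_eq mult_Suc)
  then show ?thesis
    using False assms in_degree_modular_jaco_graph_later_block[of "j mod k" k p] by simp
qed (simp add: in_degree_modular_jaco_graph_first_block)

theorem theorem2p3:
  fixes k :: nat
  assumes "k \<ge> 1"
  shows
    "(even k \<longrightarrow>
        (\<forall>i. 1 \<le> i \<and> i \<le> k \<longrightarrow> in_degree (modular_jaco_graph k) i = i div 2) \<and>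
        (\<forall>i. i > k \<and> odd i \<longrightarrow> in_degree (modular_jaco_graph k) i = k div 2 - 1) \<and>
        (\<forall>i. i > k \<and> even i \<longrightarrow> in_degree (modular_jaco_graph k) i = k div 2)) \<and>
     (odd k \<longrightarrow>
        (\<forall>i. 1 \<le> i \<and> i \<le> k \<longrightarrow> in_degree (modular_jaco_graph k) i = i div 2) \<and>
        (\<forall>i. i > k \<longrightarrow> in_degree (modular_jaco_graph k) i = k div 2))"
proof -
  \<comment> \<open>At \<open>i = k\<close> the residue is 0, and the later-block formula gives
    \<open>k div 2\<close>, continuing the first block.\<close>
  have le: "in_degree (modular_jaco_graph k) i = i div 2" if "i \<le> k" for i
    using that assms by (cases "i = k") (simp_all add: in_degree_modular_jaco_graph)
  have gt: "in_degree (modular_jaco_graph k) i = (i mod k) div 2 + (k - i mod k) div 2"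
    if "i > k" for i
    using that assms by (simp add: in_degree_modular_jaco_graph)
  have less: "i mod k < k" for i
    using assms by simp
  have parity: "even (i mod k) \<longleftrightarrow> even i" if "even k" for i
    using that by (simp add: dvd_mod_iff)
  \<comment> \<open>Each odd summand among \<open>r\<close> and \<open>k - r\<close> loses 1/2. For
    odd \<open>k\<close> exactly one of them is odd; for even \<open>k\<close> both or neither are,
    and both odd costs a full 1.\<close>
  have "r div 2 + (k - r) div 2 = (if even k \<and> odd r then k div 2 - 1 else k div 2)"
    if "r < k" for r
    using that by (auto elim!: evenE oddE)
  then show ?thesis
    using le gt less parity by auto
qed

end
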